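(* Let $G=(V,E)$ be a connected, undirected, unweighted graph, $R\subseteq V$ a set of landmarks and $H=(R,\delta_H)$ the highway. The labelling $L$ constructed by Algorithm 1 (described in the context) satisfies the highway cover property over $(G,H)$.
   Context: $d_G(u,v)$ denotes the shortest-path distance in $G$. A vertex $x$ lies on a shortest path between $u$ and $w$ if $d_G(u,x)+d_G(x,w)=d_G(u,w)$. A highway is a pair $H=(R,\delta_H)$ with $\delta_H(r_1,r_2)=d_G(r_1,r_2)$ for all $r_1,r_2\in R$. A distance labelling assigns to each $v\in V\setminus R$ a label $L(v)$, a set of entries $(r,\delta_L(r,v))$ with $r\in R$ and $\delta_L(r,v)=d_G(r,v)$. $L$ satisfies the highway cover property over $(G,H)$ if for all $s,t\in V\setminus R$ (not necessarily distinct) and every $r\in R$ there exist $(r_i,\delta_L(r_i,s))\in L(s)$ and $(r_j,\delta_L(r_j,t))\in L(t)$ such that $r_i$ lies on a shortest path between $r$ and $s$ and $r_j$ lies on a shortest path between $r$ and $t$ (possibly $r_i=r$ or $r_j=r$). Algorithm 1: initialise $L(v)=\emptyset$ for all $v\in V\setminus R$. For each $r_i\in R$ (in any order) run the following pruned BFS, in which each vertex is visited at most once and the root $r_i$ is visited at depth $0$. Keep two queues $\mathcal{Q}_{label}=\{r_i\}$ and $\mathcal{Q}_{prune}=\emptyset$ and set $n=0$. While $\mathcal{Q}_{label}$ contains vertices of depth $n$: (i) for each $u\in\mathcal{Q}_{label}$ at depth $n$ and each unvisited neighbour $v$ of $u$ (which becomes visited at depth $n+1$): if $v\in R$, enqueue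 $v$ to $\mathcal{Q}_{prune}$; otherwise enqueue $v$ to $\mathcal{Q}_{label}$ and add $(r_i,n+1)$ to $L(v)$; (ii) set $n\gets n+1$; (iii) for each $v\in\mathcal{Q}_{prune}$ at depth $n$, mark every unvisited neighbour of $v$ as visited at depth $n+1$ and enqueue it to $\mathcal{Q}_{prune}$ (no label is added). The output is $L$. *)

theory Defs
  imports
    "Graph_Theory.Digraph_Component"
    "Graph_Theory.Arc_Walk"
    "HOL-Library.While_Combinator"
begin

text \<open>The minimum exists for any two vertices of a connected graph; between
  unconnected vertices the value is unspecified.\<close>

definition gdist :: "('a, 'b) pre_digraph \<Rightarrow> 'a \<Rightarrow> 'a \<Rightarrow> nat" where
  "gdist G u v = (LEAST n. \<exists>p. pre_digraph.awalk G u p v \<and> length p = n)"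

definition on_shortest_path :: "('a, 'b) pre_digraph \<Rightarrow> 'a \<Rightarrow> 'a \<Rightarrow> 'a \<Rightarrow> bool" where
  "on_shortest_path G u x w \<longleftrightarrow> gdist G u x + gdist G x w = gdist G u w"

type_synonym 'a highway = "'a set \<times> ('a \<Rightarrow> 'a \<Rightarrow> nat)"

definition highway :: "('a, 'b) pre_digraph \<Rightarrow> 'a highway \<Rightarrow> bool" where
  "highway G H \<longleftrightarrow>
     fst H \<subseteq> verts G \<and> (\<forall>r\<^sub>1\<in>fst H. \<forall>r\<^sub>2\<in>fst H. snd H r\<^sub>1 r\<^sub>2 = gdist G r\<^sub>1 r\<^sub>2)"

text \<open>Labels are total functions on the vertex type; only their values on
  \<open>verts G - R\<close> are meaningful.\<close>

type_synonym 'a labelling = "'a \<Rightarrow> ('a \<times> nat) set"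

definition distance_labelling :: "('a, 'b) pre_digraph \<Rightarrow> 'a set \<Rightarrow> 'a labelling \<Rightarrow> bool" where
  "distance_labelling G R L \<longleftrightarrow>
     (\<forall>v\<in>verts G - R. \<forall>(r, d)\<in>L v. r \<in> R \<and> d = gdist G r v)"

definition highway_cover :: "('a, 'b) pre_digraph \<Rightarrow> 'a highway \<Rightarrow> 'a labelling \<Rightarrow> bool" where
  "highway_cover G H L \<longleftrightarrow>
     (\<forall>s\<in>verts G - fst H. \<forall>t\<in>verts G - fst H. \<forall>r\<in>fst H.
        \<exists>r\<^sub>i r\<^sub>j. (r\<^sub>i, gdist G r\<^sub>i s) \<in> L s \<and> (r\<^sub>j, gdist G r\<^sub>j t) \<in> L t \<and>
          on_shortest_path G r r\<^sub>i s \<and> on_shortest_path G r r\<^sub>j t)"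

text \<open>State of one pruned BFS. A vertex is visited iff its \<open>depth\<close> is not \<open>None\<close>.
  Vertices are never removed from the queues: both phases select the entries of the
  current depth, so earlier entries are inert.\<close>

record 'a bfs_state =
  depth :: "'a \<rightharpoonup> nat"
  Q_label :: "'a list"
  Q_prune :: "'a list"
  level :: nat
  labels :: "'a labelling"

definition at_level :: "'a bfs_state \<Rightarrow> 'a list \<Rightarrow> 'a list" where
  "at_level s Q = filter (\<lambda>u. depth s u = Some (level s)) Q"

definition label_visit :: "'a set \<Rightarrow> 'a \<Rightarrow> 'a \<Rightarrow> 'a bfs_state \<Rightarrow> 'a bfs_state" where
  "label_visit R r v s =
     (if depth s v \<noteq> None then s
      else if v \<in> R then
        s\<lparr>depth := (depth s)(v \<mapsto> level s + 1), Q_prune := Q_prune s @ [v]\<rparr>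
      else
        s\<lparr>depth := (depth s)(v \<mapsto> level s + 1), Q_label := Q_label s @ [v],
          labels := (labels s)(v := insert (r, level s + 1) (labels s v))\<rparr>)"

definition prune_visit :: "'a \<Rightarrow> 'a bfs_state \<Rightarrow> 'a bfs_state" where
  "prune_visit v s =
     (if depth s v \<noteq> None then s
      else s\<lparr>depth := (depth s)(v \<mapsto> level s + 1), Q_prune := Q_prune s @ [v]\<rparr>)"

text \<open>\<open>adj u\<close> lists the neighbours of \<open>u\<close> in the order in which they are scanned.\<close>

definition label_phase :: "('a \<Rightarrow> 'a list) \<Rightarrow> 'a set \<Rightarrow> 'a \<Rightarrow> 'a bfs_state \<Rightarrow> 'a bfs_state" where
  "label_phase adj R r s =
     fold (\<lambda>u. fold (label_visit R r) (adj u)) (at_level s (Q_label s)) s"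

definition prune_phase :: "('a \<Rightarrow> 'a list) \<Rightarrow> 'a bfs_state \<Rightarrow> 'a bfs_state" where
  "prune_phase adj s =
     fold (\<lambda>v. fold prune_visit (adj v)) (at_level s (Q_prune s)) s"

definition next_level :: "'a bfs_state \<Rightarrow> 'a bfs_state" where
  "next_level s = s\<lparr>level := level s + 1\<rparr>"

definition pruned_bfs ::
    "('a \<Rightarrow> 'a list) \<Rightarrow> 'a set \<Rightarrow> 'a \<Rightarrow> 'a labelling \<Rightarrow> 'a labelling" where
  "pruned_bfs adj R r L =
     labels (while
       (\<lambda>s. at_level s (Q_label s) \<noteq> [])
       (\<lambda>s. prune_phase adj (next_level (label_phase adj R r s)))
       \<lparr>depth = [r \<mapsto> 0], Q_label = [r], Q_prune = [], level = 0, labels = L\<rparr>)"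

text \<open>\<open>rs\<close> lists the landmarks in the order in which they are processed.\<close>

definition highway_labelling :: "('a \<Rightarrow> 'a list) \<Rightarrow> 'a list \<Rightarrow> 'a labelling" where
  "highway_labelling adj rs = fold (pruned_bfs adj (set rs)) rs (\<lambda>_. {})"

end

theory Submission
  imports Defs
begin

text \<open>Call a vertex \<open>v\<close> shadowed from the root \<open>r\<close> if a landmark other than \<open>r\<close> lies on some
  shortest path from \<open>r\<close> to \<open>v\<close>. A non-landmark at distance \<open>n + 1\<close> is shadowed iff one of its
  neighbours at distance \<open>n\<close> is. Since the prune phase of a level runs before its label phase,
  shadowed vertices are claimed by the prune queue first, so the search from \<open>r\<close> labels exactly
  the non-landmarks that are not shadowed, each with its true distance. For the cover property,
  among the landmarks on shortest paths from \<open>r\<close> to \<open>s\<close> take one closest to \<open>s\<close>: no other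
  landmark shadows \<open>s\<close> from it, so it occurs in the label of \<open>s\<close>.\<close>

section \<open>Shortest-path distances\<close>

locale strongly_connected_fin_digraph = fin_digraph +
  assumes strongly_connected: "strongly_connected G"
begin

lemma gdist_awalk:
  assumes "u \<in> verts G" "v \<in> verts G"
  obtains p where "awalk u p v" "length p = gdist G u v"
proof -
  have "\<exists>n p. awalk u p v \<and> length p = n"
    using assms strongly_connected by (auto simp: strongly_connected_def reachable_awalk)
  then have "\<exists>p. awalk u p v \<and> length p = gdist G u v"
    unfolding gdist_def by (rule LeastI_ex)
  then show thesis using that by blast
qed

lemma gdist_le: "awalk u p v \<Longrightarrow> gdist G u v \<le> length p"
  unfolding gdist_def by (rule Least_le) blast

lemma gdist_self [simp]: "u \<in> verts G \<Longrightarrow> gdist G u u = 0"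
  using gdist_le[of u "[]" u] by (simp add: awalk_Nil_iff)

lemma gdist_eq_0_iff:
  assumes "u \<in> verts G" "v \<in> verts G"
  shows "gdist G u v = 0 \<longleftrightarrow> u = v"
  using gdist_awalk[OF assms] assms by (metis awalk_empty_ends gdist_self length_0_conv)

lemma gdist_triangle:
  assumes "u \<in> verts G" "v \<in> verts G" "w \<in> verts G"
  shows "gdist G u w \<le> gdist G u v + gdist G v w"
proof -
  obtain p where p: "awalk u p v" "length p = gdist G u v" using gdist_awalk assms by blast
  obtain q where q: "awalk v q w" "length q = gdist G v w" using gdist_awalk assms by blast
  show ?thesis using gdist_le[OF awalk_appendI[OF p(1) q(1)]] p(2) q(2) by simp
qed

text \<open>Only an upper bound, since loops are possible and give distance 0.\<close>

lemma gdist_adj_le: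
  assumes "u \<rightarrow>\<^bsub>G\<^esub> v"
  shows "gdist G u v \<le> 1"
proof -
  obtain e where "e \<in> arcs G" "tail G e = u" "head G e = v" using assms by auto
  then have "awalk u [e] v" using arc_implies_awalk by auto
  then show ?thesis using gdist_le[of u "[e]" v] by simp
qed

lemma gdist_adj_step:
  assumes "r \<in> verts G" "u \<rightarrow>\<^bsub>G\<^esub> v"
  shows "gdist G r v \<le> gdist G r u + 1"
  using gdist_triangle[of r u v] gdist_adj_le[OF assms(2)] assms adj_in_verts[OF assms(2)] by simp

text \<open>Cut the last arc off a shortest walk; by the one-step bound what remains is again
  shortest.\<close>

lemma gdist_predecessor:
  assumes "u \<in> verts G" "v \<in> verts G" "u \<noteq> v"
  obtains w where "w \<rightarrow>\<^bsub>G\<^esub> v" "gdist G u v = gdist G u w + 1"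
proof -
  obtain p where p: "awalk u p v" "length p = gdist G u v" using gdist_awalk assms by blast
  have "p \<noteq> []" using p(1) assms(3) by (auto simp: awalk_Nil_iff)
  then obtain q e where pq: "p = q @ [e]" by (metis rev_exhaust)
  define w where "w = awlast u q"
  have q: "awalk u q w" and "awalk w [e] v" using p(1) pq unfolding w_def by auto
  then have w: "w \<rightarrow>\<^bsub>G\<^esub> v" by (auto simp: awalk_simps intro: in_arcs_imp_in_arcs_ends)
  have "gdist G u w \<le> length q" by (rule gdist_le[OF q])
  moreover have "gdist G u v \<le> gdist G u w + 1" by (rule gdist_adj_step[OF assms(1) w])
  ultimately show thesis using that[OF w] p(2) pq by simp
qed

section \<open>Shadowing along shortest paths\<close>

definition shadowed :: "'a set \<Rightarrow> 'a \<Rightarrow> 'a \<Rightarrow> bool" where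
  "shadowed R r v \<longleftrightarrow> (\<exists>r'\<in>R. r' \<noteq> r \<and> on_shortest_path G r r' v)"

lemma not_shadowed_root:
  assumes "R \<subseteq> verts G" "r \<in> verts G"
  shows "\<not> shadowed R r r"
  using assms by (auto simp: shadowed_def on_shortest_path_def gdist_eq_0_iff)

text \<open>The endpoint \<open>v\<close> is itself the required landmark.\<close>

lemma shadowed_landmark:
  assumes "R \<subseteq> verts G" "v \<in> R" "v \<noteq> r"
  shows "shadowed R r v"
  using assms by (auto simp: shadowed_def on_shortest_path_def intro!: bexI[of _ v])

text \<open>The landmark that shadows \<open>u\<close> also shadows \<open>v\<close>: the route
  through it and then \<open>u\<close> has length \<open>gdist G r u + 1\<close>, which is already
  the distance to \<open>v\<close>.\<close>

lemma shadowed_step: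
  assumes "R \<subseteq> verts G" "r \<in> verts G" "u \<rightarrow>\<^bsub>G\<^esub> v"
    and "gdist G r v = gdist G r u + 1" "shadowed R r u"
  shows "shadowed R r v"
proof -
  obtain r' where r': "r' \<in> R" "r' \<noteq> r" "gdist G r r' + gdist G r' u = gdist G r u"
    using assms(5) by (auto simp: shadowed_def on_shortest_path_def)
  have "r' \<in> verts G" using r'(1) assms(1) by auto
  then have "gdist G r' v \<le> gdist G r' u + 1" "gdist G r v \<le> gdist G r r' + gdist G r' v"
    using gdist_adj_step assms(3) gdist_triangle assms(2) adj_in_verts(2) by blast+
  with r' assms(4) have "on_shortest_path G r r' v"
    unfolding on_shortest_path_def by linarith
  with r' show ?thesis unfolding shadowed_def by blast
qed

text \<open>Since \<open>v\<close> is no landmark, the shadowing landmark \<open>r'\<close> differs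
  from it, and a shortest path from \<open>r'\<close> to \<open>v\<close> has a last step. The
  predecessor is taken with respect to \<open>r'\<close>; tightness of the triangle inequalities
  makes it a predecessor with respect to \<open>r\<close> too, with \<open>r'\<close> still on a
  shortest path.\<close>

lemma shadowed_predecessor:
  assumes "R \<subseteq> verts G" "r \<in> verts G" "v \<in> verts G" "v \<notin> R" "shadowed R r v"
  obtains u where "u \<rightarrow>\<^bsub>G\<^esub> v" "gdist G r v = gdist G r u + 1" "shadowed R r u"
proof -
  obtain r' where r': "r' \<in> R" "r' \<noteq> r" "gdist G r r' + gdist G r' v = gdist G r v"
    using assms(5) by (auto simp: shadowed_def on_shortest_path_def)
  have r'v: "r' \<in> verts G" "r' \<noteq> v" using r'(1) assms(1,4) by auto
  obtain u where u: "u \<rightarrow>\<^bsub>G\<^esub> v" "gdist G r' v = gdist G r' u + 1"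
    using gdist_predecessor r'v assms(3) by blast
  have "gdist G r u \<le> gdist G r r' + gdist G r' u"
    using gdist_triangle assms(2) r'v(1) adj_in_verts(1)[OF u(1)] by blast
  moreover have "gdist G r v \<le> gdist G r u + 1" by (rule gdist_adj_step[OF assms(2) u(1)])
  ultimately have "gdist G r v = gdist G r u + 1" "on_shortest_path G r r' u"
    unfolding on_shortest_path_def using r'(3) u(2) by linarith+
  then show thesis using that u(1) r' unfolding shadowed_def by blast
qed

lemma exists_unshadowed_landmark:
  assumes "R \<subseteq> verts G" "r \<in> R" "s \<in> verts G"
  obtains r' where "r' \<in> R" "on_shortest_path G r r' s" "\<not> shadowed R r' s"
proof -
  let ?P = "\<lambda>x. x \<in> R \<and> on_shortest_path G r x s"
  have "?P r" using assms by (auto simp: on_shortest_path_def)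
  then obtain r' where r': "?P r'" and min: "\<And>x. ?P x \<Longrightarrow> gdist G r' s \<le> gdist G x s"
    using ex_has_least_nat[of ?P r "\<lambda>x. gdist G x s"] by blast
  have "\<not> shadowed R r' s"
  proof
    assume "shadowed R r' s"
    then obtain x where x: "x \<in> R" "x \<noteq> r'" "gdist G r' x + gdist G x s = gdist G r' s"
      by (auto simp: shadowed_def on_shortest_path_def)
    have v: "r \<in> verts G" "r' \<in> verts G" "x \<in> verts G" using assms r' x(1) by auto
    \<comment> \<open>Any \<open>x\<close> shadowing \<open>s\<close> from \<open>r'\<close> also
      lies on a shortest path from \<open>r\<close> to \<open>s\<close>, so it competes with
      \<open>r'\<close> for the minimum and can only tie if it equals \<open>r'\<close>.\<close>
    have "gdist G r x \<le> gdist G r r' + gdist G r' x" "gdist G r s \<le> gdist G r x + gdist G x s"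
      using gdist_triangle v assms(3) by blast+
    with r' x(3) have "on_shortest_path G r x s" unfolding on_shortest_path_def by linarith
    then have "gdist G r' s \<le> gdist G x s" using min x(1) by blast
    with x(3) have "gdist G r' x = 0" by linarith
    with v x(2) show False by (simp add: gdist_eq_0_iff)
  qed
  with r' that show thesis by blast
qed

end

section \<open>Net effect of scanning a list of vertices\<close>

definition unvisited :: "'a bfs_state \<Rightarrow> 'a list \<Rightarrow> 'a set" where
  "unvisited s vs = {v \<in> set vs. depth s v = None}"

lemma label_visit_sel:
  "level (label_visit R r v s) = level s"
  "depth (label_visit R r v s) =
     (depth s)(v := if depth s v = None then Some (level s + 1) else depth s v)"
  "set (Q_label (label_visit R r v s)) =
     set (Q_label s) \<union> (if depth s v = None \<and> v \<notin> R then {v} else {})"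
  "set (Q_prune (label_visit R r v s)) =
     set (Q_prune s) \<union> (if depth s v = None \<and> v \<in> R then {v} else {})"
  "labels (label_visit R r v s) = (labels s)
     (v := labels s v \<union> (if depth s v = None \<and> v \<notin> R then {(r, level s + 1)} else {}))"
  by (auto simp: label_visit_def)

lemma prune_visit_sel:
  "level (prune_visit v s) = level s"
  "depth (prune_visit v s) =
     (depth s)(v := if depth s v = None then Some (level s + 1) else depth s v)"
  "Q_label (prune_visit v s) = Q_label s"
  "set (Q_prune (prune_visit v s)) = set (Q_prune s) \<union> (if depth s v = None then {v} else {})"
  "labels (prune_visit v s) = labels s"
  by (auto simp: prune_visit_def)

text \<open>A visit marks its vertex at once and keeps the level, so repetitions in
  \<open>vs\<close> do nothing and the result depends only on the vertices unvisited at the start.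
  Queues are compared as sets because their order does not affect the invariant.\<close>

lemma fold_label_visit:
  shows "level (fold (label_visit R r) vs s) = level s"
    and "depth (fold (label_visit R r) vs s) v =
      (if v \<in> unvisited s vs then Some (level s + 1) else depth s v)"
    and "set (Q_label (fold (label_visit R r) vs s)) = set (Q_label s) \<union> (unvisited s vs - R)"
    and "set (Q_prune (fold (label_visit R r) vs s)) = set (Q_prune s) \<union> (unvisited s vs \<inter> R)"
    and "labels (fold (label_visit R r) vs s) v =
      labels s v \<union> (if v \<in> unvisited s vs - R then {(r, level s + 1)} else {})"
proof (induction vs arbitrary: s)
  case Nil
  { case 1 show ?case by simp next
    case 2 show ?case by (simp add: unvisited_def) next
    case 3 show ?case by (simp add: unvisited_def) next
    case 4 show ?case by (simp add: unvisited_def) next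
    case 5 show ?case by (simp add: unvisited_def) }
next
  case (Cons a vs)
  { case 1 show ?case by (simp add: Cons label_visit_sel) next
    case 2 show ?case by (auto simp: Cons label_visit_sel unvisited_def) next
    case 3 show ?case by (auto simp: Cons label_visit_sel unvisited_def) next
    case 4 show ?case by (auto simp: Cons label_visit_sel unvisited_def) next
    case 5 show ?case by (auto simp: Cons label_visit_sel unvisited_def) }
qed

lemma fold_prune_visit:
  shows "level (fold prune_visit vs s) = level s"
    and "depth (fold prune_visit vs s) v =
      (if v \<in> unvisited s vs then Some (level s + 1) else depth s v)"
    and "Q_label (fold prune_visit vs s) = Q_label s"
    and "set (Q_prune (fold prune_visit vs s)) = set (Q_prune s) \<union> unvisited s vs"
    and "labels (fold prune_visit vs s) = labels s"
proof (induction vs arbitrary: s)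
  case Nil
  { case 1 show ?case by simp next
    case 2 show ?case by (simp add: unvisited_def) next
    case 3 show ?case by simp next
    case 4 show ?case by (simp add: unvisited_def) next
    case 5 show ?case by simp }
next
  case (Cons a vs)
  { case 1 show ?case by (simp add: Cons prune_visit_sel) next
    case 2 show ?case by (auto simp: Cons prune_visit_sel unvisited_def) next
    case 3 show ?case by (simp add: Cons prune_visit_sel) next
    case 4 show ?case by (auto simp: Cons prune_visit_sel unvisited_def) next
    case 5 show ?case by (simp add: Cons prune_visit_sel) }
qed

text \<open>Flattens the nested loops of a phase into a single scan.\<close>

lemma fold_fold_concat: "fold (\<lambda>u. fold f (g u)) us = fold f (concat (map g us))"
  by (induction us) auto

section \<open>The pruned search from a single landmark\<close>

locale landmark_bfs = strongly_connected_fin_digraph +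
  fixes R :: "'a set" and adj :: "'a \<Rightarrow> 'a list" and r :: 'a
  assumes R_verts: "R \<subseteq> verts G" and r_in_R: "r \<in> R"
    and set_adj: "u \<in> verts G \<Longrightarrow> set (adj u) = {v. u \<rightarrow>\<^bsub>G\<^esub> v}"
begin

abbreviation D :: "'a \<Rightarrow> nat" where
  "D \<equiv> gdist G r"

abbreviation shad :: "'a \<Rightarrow> bool" where
  "shad \<equiv> shadowed R r"

lemma r_verts: "r \<in> verts G"
  using R_verts r_in_R by blast

lemma D_eq_0_iff: "v \<in> verts G \<Longrightarrow> D v = 0 \<longleftrightarrow> v = r"
  using gdist_eq_0_iff[OF r_verts] by auto

lemma D_step: "u \<rightarrow>\<^bsub>G\<^esub> v \<Longrightarrow> D v \<le> D u + 1"
  by (rule gdist_adj_step[OF r_verts])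

lemma D_predecessor:
  assumes "v \<in> verts G" "D v = Suc n"
  obtains u where "u \<rightarrow>\<^bsub>G\<^esub> v" "D u = n"
proof -
  have "r \<noteq> v" using assms r_verts by auto
  then obtain u where "u \<rightarrow>\<^bsub>G\<^esub> v" "D v = D u + 1"
    using gdist_predecessor[OF r_verts assms(1)] by blast
  with assms(2) that show thesis by simp
qed

text \<open>The vertices one level ahead of the label phase, already claimed by the prune phase.\<close>

definition pruned_ahead :: "nat \<Rightarrow> 'a set" where
  "pruned_ahead n = {v \<in> verts G. D v = Suc n \<and> (\<exists>u. u \<rightarrow>\<^bsub>G\<^esub> v \<and> D u = n \<and> shad u)}"

lemma pruned_ahead_shadowed: "v \<in> pruned_ahead n \<Longrightarrow> shad v"
  using shadowed_step[OF R_verts r_verts] by (auto simp: pruned_ahead_def)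

text \<open>Justifies the membership test in \<open>label_visit\<close>: a shadowed non-landmark has
  a shadowed predecessor one level below, so the prune phase has already claimed it; a landmark here
  is at positive distance and hence not the root.\<close>

lemma shadowed_iff_landmark:
  assumes "v \<in> verts G" "D v = Suc n" "v \<notin> pruned_ahead n"
  shows "shad v \<longleftrightarrow> v \<in> R"
proof
  assume "shad v"
  show "v \<in> R"
  proof (rule ccontr)
    assume "v \<notin> R"
    then obtain u where "u \<rightarrow>\<^bsub>G\<^esub> v" "D v = D u + 1" "shad u"
      using shadowed_predecessor[OF R_verts r_verts assms(1) _ \<open>shad v\<close>] by blast
    with assms show False by (auto simp: pruned_ahead_def)
  qed
next
  assume "v \<in> R"
  moreover have "v \<noteq> r" using assms(2) r_verts by auto
  ultimately show "shad v" using shadowed_landmark[OF R_verts] by blast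
qed

text \<open>\<open>A\<close> is the set of visited vertices. Keeping it as a parameter, and leaving
  the level out, lets one description serve between the phases as well as at the loop head.\<close>

definition bfs_state_for :: "'a labelling \<Rightarrow> 'a set \<Rightarrow> 'a bfs_state \<Rightarrow> bool" where
  "bfs_state_for L A s \<longleftrightarrow>
     (\<forall>v. depth s v = (if v \<in> A then Some (D v) else None)) \<and>
     set (Q_label s) = {v \<in> A. \<not> shad v} \<and>
     set (Q_prune s) = {v \<in> A. shad v} \<and>
     (\<forall>v. labels s v = L v \<union> (if v \<in> A - R \<and> \<not> shad v then {(r, D v)} else {}))"

abbreviation dball :: "nat \<Rightarrow> 'a set" where
  "dball n \<equiv> {v \<in> verts G. D v \<le> n}"

text \<open>At the loop head the prune phase of the current level has run and its label phase has
  not.\<close>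

definition bfs_inv :: "'a labelling \<Rightarrow> 'a bfs_state \<Rightarrow> bool" where
  "bfs_inv L s \<longleftrightarrow> bfs_state_for L (dball (level s) \<union> pruned_ahead (level s)) s"

lemma at_level_Q_label:
  assumes "bfs_inv L s"
  shows "set (at_level s (Q_label s)) = {v \<in> verts G. D v = level s \<and> \<not> shad v}"
  using assms by (auto simp: bfs_inv_def bfs_state_for_def at_level_def pruned_ahead_def)

lemma bfs_inv_init:
  "bfs_inv L \<lparr>depth = [r \<mapsto> 0], Q_label = [r], Q_prune = [], level = 0, labels = L\<rparr>"
proof -
  have "\<not> shad r" by (rule not_shadowed_root[OF R_verts r_verts])
  \<comment> \<open>The root is the only vertex at distance 0 and is unshadowed, so the loop may
    start without a prune phase at level 0.\<close>
  then have "pruned_ahead 0 = {}"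
    by (auto simp: pruned_ahead_def) (metis D_eq_0_iff adj_in_verts(1))
  moreover have "dball 0 = {r}" using D_eq_0_iff r_verts by auto
  ultimately have "dball 0 \<union> pruned_ahead 0 = {r}" by simp
  with \<open>\<not> shad r\<close> r_in_R r_verts show ?thesis
    by (auto simp: bfs_inv_def bfs_state_for_def)
qed

lemma label_phase_complete:
  assumes "bfs_inv L s"
  shows "level (label_phase adj R r s) = level s"
    and "bfs_state_for L (dball (Suc (level s))) (label_phase adj R r s)"
proof -
  define n where "n = level s"
  define vs where "vs = concat (map adj (at_level s (Q_label s)))"
  define N where "N = {v \<in> verts G. D v = Suc n} - pruned_ahead n"
  have phase: "label_phase adj R r s = fold (label_visit R r) vs s"
    by (simp add: label_phase_def fold_fold_concat vs_def)
  have inv: "bfs_state_for L (dball n \<union> pruned_ahead n) s"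
    using assms by (simp add: bfs_inv_def n_def)
  have vs: "set vs = {v. \<exists>u. u \<rightarrow>\<^bsub>G\<^esub> v \<and> D u = n \<and> \<not> shad u}"
    using at_level_Q_label[OF assms] set_adj
    by (auto simp: vs_def n_def dest: adj_in_verts(1))
  have N: "unvisited s vs = N"
  proof (intro set_eqI iffI)
    fix v assume "v \<in> unvisited s vs"
    then obtain u where "u \<rightarrow>\<^bsub>G\<^esub> v" "D u = n" "v \<notin> dball n \<union> pruned_ahead n"
      using inv vs by (auto simp: unvisited_def bfs_state_for_def split: if_splits)
    then show "v \<in> N" using D_step[of u v] adj_in_verts(2)[of u v] by (auto simp: N_def)
  next
    fix v assume "v \<in> N"
    then have v: "v \<in> verts G" "D v = Suc n" "v \<notin> pruned_ahead n" by (auto simp: N_def)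
    then obtain u where "u \<rightarrow>\<^bsub>G\<^esub> v" "D u = n" by (rule_tac D_predecessor)
    \<comment> \<open>The predecessor is unshadowed, as otherwise \<open>v\<close> would be pruned
      ahead; hence this phase scans it.\<close>
    with v have "v \<in> set vs" by (auto simp: vs pruned_ahead_def)
    with v show "v \<in> unvisited s vs"
      using inv by (auto simp: unvisited_def bfs_state_for_def)
  qed
  have NR: "shad v \<longleftrightarrow> v \<in> R" "D v = Suc n" if "v \<in> N" for v
    using that shadowed_iff_landmark by (auto simp: N_def)
  have A: "dball (Suc n) = (dball n \<union> pruned_ahead n) \<union> N"
    by (auto simp: N_def pruned_ahead_def)
  have disj: "(dball n \<union> pruned_ahead n) \<inter> N = {}" by (auto simp: N_def)
  show "level (label_phase adj R r s) = level s" by (simp add: phase fold_label_visit)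
  have "bfs_state_for L ((dball n \<union> pruned_ahead n) \<union> N) (fold (label_visit R r) vs s)"
    using inv NR disj unfolding bfs_state_for_def fold_label_visit N n_def[symmetric]
    by (intro conjI allI) auto
  then show "bfs_state_for L (dball (Suc (level s))) (label_phase adj R r s)"
    unfolding phase n_def[symmetric] A .
qed

text \<open>With the whole ball visited, an unvisited neighbour of a shadowed vertex of the current
  level lies exactly one level further, and it inherits the shadow, so the prune queue is the right
  place for it.\<close>

lemma prune_phase_ahead:
  assumes "bfs_state_for L (dball (level s)) s"
  shows "level (prune_phase adj s) = level s" and "bfs_inv L (prune_phase adj s)"
proof -
  define n where "n = level s"
  define vs where "vs = concat (map adj (at_level s (Q_prune s)))"
  have phase: "prune_phase adj s = fold prune_visit vs s"
    by (simp add: prune_phase_def fold_fold_concat vs_def)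
  have inv: "bfs_state_for L (dball n) s" using assms by (simp add: n_def)
  have "set (at_level s (Q_prune s)) = {v \<in> verts G. D v = n \<and> shad v}"
    using inv by (auto simp: at_level_def bfs_state_for_def n_def)
  then have vs: "set vs = {v. \<exists>u. u \<rightarrow>\<^bsub>G\<^esub> v \<and> D u = n \<and> shad u}"
    using set_adj by (auto simp: vs_def dest: adj_in_verts(1))
  have N: "unvisited s vs = pruned_ahead n"
  proof (intro set_eqI iffI)
    fix v assume "v \<in> unvisited s vs"
    then obtain u where "u \<rightarrow>\<^bsub>G\<^esub> v" "D u = n" "shad u" "v \<notin> dball n"
      using inv vs by (auto simp: unvisited_def bfs_state_for_def split: if_splits)
    then show "v \<in> pruned_ahead n"
      using D_step[of u v] adj_in_verts(2)[of u v] by (auto simp: pruned_ahead_def)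
  next
    fix v assume "v \<in> pruned_ahead n"
    then show "v \<in> unvisited s vs"
      using inv vs by (auto simp: unvisited_def bfs_state_for_def pruned_ahead_def)
  qed
  have NR: "shad v" "D v = Suc n" if "v \<in> pruned_ahead n" for v
    using that pruned_ahead_shadowed[OF that] by (simp_all add: pruned_ahead_def)
  show "level (prune_phase adj s) = level s" by (simp add: phase fold_prune_visit)
  have "bfs_state_for L (dball n \<union> pruned_ahead n) (fold prune_visit vs s)"
    using inv NR unfolding bfs_state_for_def fold_prune_visit N n_def[symmetric]
    by (intro conjI allI) auto
  then show "bfs_inv L (prune_phase adj s)"
    unfolding bfs_inv_def phase fold_prune_visit n_def .
qed

lemma bfs_inv_step:
  assumes "bfs_inv L s"
  defines "s' \<equiv> prune_phase adj (next_level (label_phase adj R r s))"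
  shows "bfs_inv L s'" and "level s' = Suc (level s)"
proof -
  let ?t = "next_level (label_phase adj R r s)"
  have t: "level ?t = Suc (level s)"
    by (simp add: next_level_def label_phase_complete(1)[OF assms(1)])
  have "bfs_state_for L (dball (level ?t)) ?t"
    unfolding t using label_phase_complete(2)[OF assms(1)]
    by (simp add: bfs_state_for_def next_level_def)
  from prune_phase_ahead[OF this] show "bfs_inv L s'" "level s' = Suc (level s)"
    by (simp_all add: s'_def t)
qed

text \<open>Shows that stopping loses no label: shadows propagate from a predecessor, so once a
  level is entirely shadowed, so is everything farther away.\<close>

lemma shadowed_beyond_exhausted_level:
  assumes "\<And>v. v \<in> verts G \<Longrightarrow> D v = n \<Longrightarrow> shad v"
    and "v \<in> verts G" "n \<le> D v"
  shows "shad v"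
  using assms(2,3)
proof (induction "D v" arbitrary: v)
  case 0
  then show ?case using assms(1) by simp
next
  case (Suc m)
  show ?case
  proof (cases "n = D v")
    case True
    then show ?thesis using assms(1) Suc.prems(1) by simp
  next
    case False
    obtain u where u: "u \<rightarrow>\<^bsub>G\<^esub> v" "D u = m"
      using D_predecessor[OF Suc.prems(1) Suc.hyps(2)[symmetric]] by blast
    have "shad u"
      using Suc.hyps(1)[of u] adj_in_verts(1)[OF u(1)] u(2) False Suc.prems(2) Suc.hyps(2) by simp
    then show ?thesis
      using shadowed_step[OF R_verts r_verts u(1)] u(2) Suc.hyps(2) by simp
  qed
qed

theorem pruned_bfs_labels:
  "pruned_bfs adj R r L v =
     L v \<union> (if v \<in> verts G - R \<and> \<not> shad v then {(r, D v)} else {})"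
  unfolding pruned_bfs_def
proof (rule while_rule[where P = "bfs_inv L"
      and r = "measure (\<lambda>s. Suc (Max (D ` verts G)) - level s)"])
  fix s :: "'a bfs_state"
  assume inv: "bfs_inv L s" and exhausted: "\<not> at_level s (Q_label s) \<noteq> []"
  have "shad u" if "u \<in> verts G" "D u = level s" for u
    using at_level_Q_label[OF inv] exhausted that by auto
  \<comment> \<open>Every unshadowed vertex is therefore closer than the current level, inside the
    visited ball.\<close>
  then have "shad u" if "u \<in> verts G" "level s \<le> D u" for u
    using shadowed_beyond_exhausted_level that by blast
  with inv show "labels s v = L v \<union> (if v \<in> verts G - R \<and> \<not> shad v then {(r, D v)} else {})"
    by (auto simp: bfs_inv_def bfs_state_for_def pruned_ahead_def split: if_splits)
next
  fix s :: "'a bfs_state"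
  assume inv: "bfs_inv L s" and "at_level s (Q_label s) \<noteq> []"
  then obtain v where "v \<in> verts G" "D v = level s"
    using at_level_Q_label[OF inv] by (metis (mono_tags, lifting) mem_Collect_eq set_empty ex_in_conv)
  \<comment> \<open>While the loop runs, the level is a distance that occurs; the \<open>Suc\<close>
    in the measure makes it drop even at the largest one.\<close>
  then have "level s \<le> Max (D ` verts G)" by (metis Max_ge finite_imageI finite_verts imageI)
  then show "(prune_phase adj (next_level (label_phase adj R r s)), s)
      \<in> measure (\<lambda>s. Suc (Max (D ` verts G)) - level s)"
    using bfs_inv_step(2)[OF inv] by simp
qed (simp_all add: bfs_inv_init bfs_inv_step)

end

section \<open>All landmarks together and the cover property\<close>

context strongly_connected_fin_digraph
begin

text \<open>Each run only adds entries, and which ones does not depend on earlier runs.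
  \<open>R\<close> is kept apart from \<open>rs\<close> so that the landmark set stays fixed while
  the list shrinks in the induction.\<close>

lemma fold_pruned_bfs_labels:
  assumes "R \<subseteq> verts G" "set rs \<subseteq> R"
    and "\<And>u. u \<in> verts G \<Longrightarrow> set (adj u) = {v. u \<rightarrow>\<^bsub>G\<^esub> v}"
  shows "fold (pruned_bfs adj R) rs L v =
    L v \<union> {(r, gdist G r v) | r. r \<in> set rs \<and> v \<in> verts G - R \<and> \<not> shadowed R r v}"
  using assms(2)
proof (induction rs arbitrary: L)
  case Nil
  then show ?case by simp
next
  case (Cons r rs)
  interpret landmark_bfs G R adj r
    by unfold_locales (use assms Cons.prems in auto)
  show ?case using Cons by (auto simp: pruned_bfs_labels)
qed

lemma highway_labelling_eq:
  assumes "set rs \<subseteq> verts G"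
    and "\<And>u. u \<in> verts G \<Longrightarrow> set (adj u) = {v. u \<rightarrow>\<^bsub>G\<^esub> v}"
  shows "highway_labelling adj rs v =
    {(r, gdist G r v) | r. r \<in> set rs \<and> v \<in> verts G - set rs \<and> \<not> shadowed (set rs) r v}"
  unfolding highway_labelling_def using fold_pruned_bfs_labels[OF assms(1) order_refl assms(2)]
  by simp

end

text \<open>Connectedness is strong connectedness of the symmetric closure, and reachability there
  agrees with that in \<open>G\<close> because the arcs are already symmetric.\<close>

lemma (in pseudo_graph) connected_imp_strongly_connected:
  assumes "Digraph_Component.connected G"
  shows "strongly_connected G"
  using assms reachable_mk_symmetric_eq[OF sym_arcs]
  by (simp add: connected_def strongly_connected_def)

theorem theorem3p9:
  fixes G :: "('a, 'b) pre_digraph"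
    and R :: "'a set"
    and \<delta>\<^sub>H :: "'a \<Rightarrow> 'a \<Rightarrow> nat"
    and rs :: "'a list"
    and adj :: "'a \<Rightarrow> 'a list"
  assumes "pseudo_graph G"
    and "Digraph_Component.connected G"
    and "R \<subseteq> verts G"
    and "highway G (R, \<delta>\<^sub>H)"
    and "distinct rs" and "set rs = R"
    and "\<And>u. u \<in> verts G \<Longrightarrow> distinct (adj u) \<and> set (adj u) = {v. u \<rightarrow>\<^bsub>G\<^esub> v}"
  shows "distance_labelling G R (highway_labelling adj rs)
    \<and> highway_cover G (R, \<delta>\<^sub>H) (highway_labelling adj rs)"
proof -
  interpret pseudo_graph G by fact
  interpret strongly_connected_fin_digraph G
    by unfold_locales (rule connected_imp_strongly_connected[OF assms(2)])
  have L: "highway_labelling adj rs v =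
      {(r, gdist G r v) | r. r \<in> R \<and> v \<in> verts G - R \<and> \<not> shadowed R r v}" for v
    using highway_labelling_eq[of rs adj v] assms(3,6,7) by simp
  \<comment> \<open>The entries for \<open>s\<close> and \<open>t\<close> are chosen independently,
    so one vertex at a time suffices.\<close>
  have "\<exists>r'. (r', gdist G r' s) \<in> highway_labelling adj rs s \<and> on_shortest_path G r r' s"
    if s: "s \<in> verts G - R" and r: "r \<in> R" for s r
  proof -
    obtain r' where "r' \<in> R" "on_shortest_path G r r' s" "\<not> shadowed R r' s"
      using exists_unshadowed_landmark assms(3) r s by blast
    with s show ?thesis by (auto simp: L)
  qed
  then have "highway_cover G (R, \<delta>\<^sub>H) (highway_labelling adj rs)"
    unfolding highway_cover_def fst_conv by meson
  moreover have "distance_labelling G R (highway_labelling adj rs)"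
    by (auto simp: distance_labelling_def L)
  ultimately show ?thesis by blast
qed

end
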